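(* Let $K=\{k_1,\ldots,k_t\}$ be a finite set of Wang tiles with relations $T_R,T_D\subseteq K\times K$ such that there exists a tiling $C:\mathbb{Z}\times\mathbb{Z}\to K$ with $T_R(C(x,y),C(x+1,y))$ and $T_D(C(x,y),C(x,y+1))$ for all $x,y\in\mathbb{Z}$, but no such tiling is periodic. Let $\phi_2$ be the sentence described in the context, built from $K$. If $G$ is a finite model of $\phi_2$ whose Gaifman graph with respect to $L,R,U,D$ is connected, then $G$, restricted to $L,R,U,D$, is isomorphic to a rectangular grid.
   Context: A tiling $C:\mathbb{Z}\times\mathbb{Z}\to K$ is periodic if there is $(x_0,y_0)\ne(0,0)$ with $C(x,y)=C(x+x_0,y+y_0)$ for all $x,y$. A rectangular grid is a structure $(V,L,R,U,D)$ with $V=\{0,\ldots,x^*\}\times\{0,\ldots,y^*\}$ for some integers $x^*,y^*\ge0$, where the binary relations hold exactly in the cases (whenever both vertices exist) $L((x,y),(x-1,y))$, $R((x,y),(x+1,y))$, $U((x,y),(x,y-1))$, $D((x,y),(x,y+1))$. The signature consists of binary $L,R,U,D$, unary $B_V,B_H$, and one unary relation symbol (also denoted $k$) for each tile $k\in K$. $\phi_2$ is the conjunction of $\phi_1$ and the tiling axioms, where $\phi_1$ is the conjunction of: (Partial functionality) for each $X\in\{L,R,U,D\}$, $\forall x\forall y\forall z\,(X(x,y)\wedge X(x,z)\Rightarrow y=z)$, writing $X(x)$ for the unique such $y$; (Inverses) $R(x,y)\iff L(y,x)$ and $U(x,y)\iff D(y,x)$ for all $x,y$; (Commutativity) for $H\in\{L,R\}$,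 $V\in\{U,D\}$: $\forall x\forall y\forall z\,(H(x,y)\wedge V(x,z)\Rightarrow\exists t\,(H(z,t)\wedge V(y,t)))$; (Horizontal counter) $\forall x\,((\neg\exists y\,U(x,y))\Rightarrow\neg B_V(x))$, $\forall x\,((\exists y\,U(x,y))\Rightarrow((B_V(x)\not\iff B_V(U(x)))\iff C(x)))$ with $C(x)\equiv(\neg\exists y\,L(x,y))\vee(\neg B_V(L(x))\wedge B_V(U(L(x))))$, and $\forall x\,((\neg\exists y\,R(x,y))\Rightarrow\neg B_V(x))$; (Vertical counter) $\forall x\,((\neg\exists y\,R(x,y))\Rightarrow\neg B_H(x))$, $\forall x\,((\exists y\,R(x,y))\Rightarrow((B_H(x)\not\iff B_H(R(x)))\iff C'(x)))$ with $C'(x)\equiv(\neg\exists y\,D(x,y))\vee(\neg B_H(D(x))\wedge B_H(R(D(x))))$, and $\forall x\,((\neg\exists y\,U(x,y))\Rightarrow\neg B_H(x))$. The tiling axioms are: (Full tiling) every element satisfies exactly one tile relation $k\in K$; (Correct tiling) for all $k_1,k_2\in K$ with $\neg T_R(k_1,k_2)$: $\neg\exists v\,(k_1(v)\wedge k_2(R(v)))$, and for all $k_1,k_2$ with $\neg T_D(k_1,k_2)$: $\neg\exists v\,(k_1(v)\wedge k_2(D(v)))$. *)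

theory Defs
  imports Main
begin

definition is_tiling ::
  "'k set \<Rightarrow> ('k \<times> 'k) set \<Rightarrow> ('k \<times> 'k) set \<Rightarrow> (int \<times> int \<Rightarrow> 'k) \<Rightarrow> bool" where
  "is_tiling K TR TD C \<longleftrightarrow>
     (\<forall>x y. C (x, y) \<in> K) \<and>
     (\<forall>x y. (C (x, y), C (x + 1, y)) \<in> TR) \<and>
     (\<forall>x y. (C (x, y), C (x, y + 1)) \<in> TD)"

definition periodic :: "(int \<times> int \<Rightarrow> 'k) \<Rightarrow> bool" where
  "periodic C \<longleftrightarrow>
     (\<exists>x0 y0. (x0, y0) \<noteq> (0, 0) \<and> (\<forall>x y. C (x, y) = C (x + x0, y + y0)))"

record 'a lrud_struct =
  universe :: "'a set"
  relL :: "'a \<Rightarrow> 'a \<Rightarrow> bool"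
  relR :: "'a \<Rightarrow> 'a \<Rightarrow> bool"
  relU :: "'a \<Rightarrow> 'a \<Rightarrow> bool"
  relD :: "'a \<Rightarrow> 'a \<Rightarrow> bool"

text \<open>Only the relations \<open>tile G k\<close> with \<open>k \<in> K\<close> belong to the signature built from \<open>K\<close>;
  the values of \<open>tile G\<close> outside \<open>K\<close> are irrelevant.\<close>

record ('a, 'k) tile_struct = "'a lrud_struct" +
  BV :: "'a \<Rightarrow> bool"
  BH :: "'a \<Rightarrow> bool"
  tile :: "'k \<Rightarrow> 'a \<Rightarrow> bool"

abbreviation lrud_reduct :: "('a, 'k) tile_struct \<Rightarrow> 'a lrud_struct" where
  "lrud_reduct G \<equiv> lrud_struct.truncate G"

text \<open>As usual in first-order logic, universes are nonempty; relations live on the universe.\<close>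

definition is_structure :: "'k set \<Rightarrow> ('a, 'k) tile_struct \<Rightarrow> bool" where
  "is_structure K G \<longleftrightarrow>
     universe G \<noteq> {} \<and>
     (\<forall>X \<in> {relL G, relR G, relU G, relD G}. \<forall>x y. X x y \<longrightarrow> x \<in> universe G \<and> y \<in> universe G) \<and>
     (\<forall>P \<in> {BV G, BH G} \<union> tile G ` K. \<forall>x. P x \<longrightarrow> x \<in> universe G)"

text \<open>\<open>defined_at G X x\<close> says that the partial function \<open>X\<close> is defined at \<open>x\<close>, and \<open>holds_at G X P x\<close>
  renders \<open>P(X(x))\<close>, which is false when \<open>X(x)\<close> is undefined. Nested applications compose:
  \<open>P(X(Y(x)))\<close> is \<open>holds_at G Y (holds_at G X P) x\<close>.\<close>

definition defined_at :: "('a, 'k) tile_struct \<Rightarrow> ('a \<Rightarrow> 'a \<Rightarrow> bool) \<Rightarrow> 'a \<Rightarrow> bool" where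
  "defined_at G X x \<longleftrightarrow> (\<exists>y \<in> universe G. X x y)"

definition holds_at :: "('a, 'k) tile_struct \<Rightarrow> ('a \<Rightarrow> 'a \<Rightarrow> bool) \<Rightarrow> ('a \<Rightarrow> bool) \<Rightarrow> 'a \<Rightarrow> bool" where
  "holds_at G X P x \<longleftrightarrow> (\<exists>y \<in> universe G. X x y \<and> P y)"

definition partial_functionality :: "('a, 'k) tile_struct \<Rightarrow> bool" where
  "partial_functionality G \<longleftrightarrow>
     (\<forall>X \<in> {relL G, relR G, relU G, relD G}.
        \<forall>x \<in> universe G. \<forall>y \<in> universe G. \<forall>z \<in> universe G. X x y \<and> X x z \<longrightarrow> y = z)"

definition inverses :: "('a, 'k) tile_struct \<Rightarrow> bool" where
  "inverses G \<longleftrightarrow>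
     (\<forall>x \<in> universe G. \<forall>y \<in> universe G. (relR G x y \<longleftrightarrow> relL G y x) \<and> (relU G x y \<longleftrightarrow> relD G y x))"

definition commutativity :: "('a, 'k) tile_struct \<Rightarrow> bool" where
  "commutativity G \<longleftrightarrow>
     (\<forall>H \<in> {relL G, relR G}. \<forall>V \<in> {relU G, relD G}.
        \<forall>x \<in> universe G. \<forall>y \<in> universe G. \<forall>z \<in> universe G.
          H x y \<and> V x z \<longrightarrow> (\<exists>t \<in> universe G. H z t \<and> V y t))"

definition carry_horizontal :: "('a, 'k) tile_struct \<Rightarrow> 'a \<Rightarrow> bool" where
  "carry_horizontal G x \<longleftrightarrow>
     \<not> defined_at G (relL G) x \<or>
     (\<not> holds_at G (relL G) (BV G) x \<and> holds_at G (relL G) (holds_at G (relU G) (BV G)) x)"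

definition horizontal_counter :: "('a, 'k) tile_struct \<Rightarrow> bool" where
  "horizontal_counter G \<longleftrightarrow>
     (\<forall>x \<in> universe G. \<not> defined_at G (relU G) x \<longrightarrow> \<not> BV G x) \<and>
     (\<forall>x \<in> universe G. defined_at G (relU G) x \<longrightarrow>
        (\<not> (BV G x \<longleftrightarrow> holds_at G (relU G) (BV G) x) \<longleftrightarrow> carry_horizontal G x)) \<and>
     (\<forall>x \<in> universe G. \<not> defined_at G (relR G) x \<longrightarrow> \<not> BV G x)"

definition carry_vertical :: "('a, 'k) tile_struct \<Rightarrow> 'a \<Rightarrow> bool" where
  "carry_vertical G x \<longleftrightarrow>
     \<not> defined_at G (relD G) x \<or>
     (\<not> holds_at G (relD G) (BH G) x \<and> holds_at G (relD G) (holds_at G (relR G) (BH G)) x)"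

definition vertical_counter :: "('a, 'k) tile_struct \<Rightarrow> bool" where
  "vertical_counter G \<longleftrightarrow>
     (\<forall>x \<in> universe G. \<not> defined_at G (relR G) x \<longrightarrow> \<not> BH G x) \<and>
     (\<forall>x \<in> universe G. defined_at G (relR G) x \<longrightarrow>
        (\<not> (BH G x \<longleftrightarrow> holds_at G (relR G) (BH G) x) \<longleftrightarrow> carry_vertical G x)) \<and>
     (\<forall>x \<in> universe G. \<not> defined_at G (relU G) x \<longrightarrow> \<not> BH G x)"

definition full_tiling :: "'k set \<Rightarrow> ('a, 'k) tile_struct \<Rightarrow> bool" where
  "full_tiling K G \<longleftrightarrow> (\<forall>x \<in> universe G. \<exists>!k. k \<in> K \<and> tile G k x)"

definition correct_tiling ::
  "'k set \<Rightarrow> ('k \<times> 'k) set \<Rightarrow> ('k \<times> 'k) set \<Rightarrow> ('a, 'k) tile_struct \<Rightarrow> bool" where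
  "correct_tiling K TR TD G \<longleftrightarrow>
     (\<forall>k1 \<in> K. \<forall>k2 \<in> K. (k1, k2) \<notin> TR \<longrightarrow>
        \<not> (\<exists>v \<in> universe G. tile G k1 v \<and> holds_at G (relR G) (tile G k2) v)) \<and>
     (\<forall>k1 \<in> K. \<forall>k2 \<in> K. (k1, k2) \<notin> TD \<longrightarrow>
        \<not> (\<exists>v \<in> universe G. tile G k1 v \<and> holds_at G (relD G) (tile G k2) v))"

definition phi1 :: "('a, 'k) tile_struct \<Rightarrow> bool" where
  "phi1 G \<longleftrightarrow>
     partial_functionality G \<and> inverses G \<and> commutativity G \<and>
     horizontal_counter G \<and> vertical_counter G"

definition phi2 ::
  "'k set \<Rightarrow> ('k \<times> 'k) set \<Rightarrow> ('k \<times> 'k) set \<Rightarrow> ('a, 'k) tile_struct \<Rightarrow> bool" where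
  "phi2 K TR TD G \<longleftrightarrow> phi1 G \<and> full_tiling K G \<and> correct_tiling K TR TD G"

definition is_model_phi2 ::
  "'k set \<Rightarrow> ('k \<times> 'k) set \<Rightarrow> ('k \<times> 'k) set \<Rightarrow> ('a, 'k) tile_struct \<Rightarrow> bool" where
  "is_model_phi2 K TR TD G \<longleftrightarrow> is_structure K G \<and> phi2 K TR TD G"

definition gaifman_adj :: "'a lrud_struct \<Rightarrow> 'a \<Rightarrow> 'a \<Rightarrow> bool" where
  "gaifman_adj S x y \<longleftrightarrow>
     x \<in> universe S \<and> y \<in> universe S \<and> x \<noteq> y \<and>
     (\<exists>X \<in> {relL S, relR S, relU S, relD S}. X x y \<or> X y x)"

definition gaifman_connected :: "'a lrud_struct \<Rightarrow> bool" where
  "gaifman_connected S \<longleftrightarrow> (\<forall>x \<in> universe S. \<forall>y \<in> universe S. (gaifman_adj S)\<^sup>*\<^sup>* x y)"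

definition rect_grid :: "int \<Rightarrow> int \<Rightarrow> (int \<times> int) lrud_struct" where
  "rect_grid m n =
     (let V = {0..m} \<times> {0..n} in
      \<lparr> universe = V,
        relL = (\<lambda>(x, y) q. (x, y) \<in> V \<and> q \<in> V \<and> q = (x - 1, y)),
        relR = (\<lambda>(x, y) q. (x, y) \<in> V \<and> q \<in> V \<and> q = (x + 1, y)),
        relU = (\<lambda>(x, y) q. (x, y) \<in> V \<and> q \<in> V \<and> q = (x, y - 1)),
        relD = (\<lambda>(x, y) q. (x, y) \<in> V \<and> q \<in> V \<and> q = (x, y + 1)) \<rparr>)"

definition lrud_isomorphic :: "'a lrud_struct \<Rightarrow> 'b lrud_struct \<Rightarrow> bool" where
  "lrud_isomorphic S T \<longleftrightarrow>
     (\<exists>f. bij_betw f (universe S) (universe T) \<and>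
        (\<forall>x \<in> universe S. \<forall>y \<in> universe S.
           (relL S x y \<longleftrightarrow> relL T (f x) (f y)) \<and>
           (relR S x y \<longleftrightarrow> relR T (f x) (f y)) \<and>
           (relU S x y \<longleftrightarrow> relU T (f x) (f y)) \<and>
           (relD S x y \<longleftrightarrow> relD T (f x) (f y))))"

end

theory Submission
  imports Defs
begin

text \<open>By commutativity, whether one of the four moves is possible is constant along the two
  perpendicular directions. In a finite connected structure, hence, either all rows are cycles or
  all rows are paths, and likewise for columns. If rows and columns are all cycles, unrolling the
  resulting torus yields a periodic tiling. If the rows are cycles and the columns are paths, the
  bits \<open>B\<^sub>H\<close> alternate along the bottom row, and a nonconstant cyclic row contains a
  carry, which makes the row above nonconstant as well; so the top row is nonconstant, although all
  its bits are \<open>0\<close>. The case of cyclic columns is symmetric, with \<open>B\<^sub>V\<close>. In the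
  remaining case every element has unique coordinates relative to the top left corner.\<close>

section \<open>Partial injections\<close>

lemma Domainp_conversep [simp]: "Domainp R\<inverse>\<inverse> = Rangep R"
  by (auto simp: fun_eq_iff Domainp_iff Rangep.simps)

lemma Rangep_conversep [simp]: "Rangep R\<inverse>\<inverse> = Domainp R"
  by (auto simp: fun_eq_iff Domainp_iff Rangep.simps)

lemma relpowp_right_uniqueD:
  fixes R :: "'a \<Rightarrow> 'a \<Rightarrow> bool"
  assumes "right_unique R" "(R ^^ n) x y" "(R ^^ n) x z"
  shows "y = z"
  using assms(2,3)
proof (induction n arbitrary: y z)
  case (Suc n)
  then show ?case
    using assms(1) by (metis relpowp_Suc_E right_uniqueD)
qed simp

text \<open>A longer walk would have to be at \<open>e\<close> after \<open>m\<close> steps and then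
  continue from there.\<close>

lemma relpowp_maximal:
  fixes R :: "'a \<Rightarrow> 'a \<Rightarrow> bool"
  assumes "right_unique R" "(R ^^ m) a e" "\<not> Domainp R e" "(R ^^ i) a x"
  shows "i \<le> m"
proof (rule ccontr)
  assume "\<not> i \<le> m"
  then obtain k where "i = m + Suc k"
    using less_natE by (metis not_le add_Suc_right)
  then have "((R ^^ m) OO (R ^^ Suc k)) a x"
    using assms(4) by (simp only: relpowp_add)
  then obtain b where b: "(R ^^ m) a b" "(R ^^ Suc k) b x" by (rule relcomppE)
  have "b = e"
    using relpowp_right_uniqueD[OF assms(1) b(1) assms(2)] .
  then show False
    using relpowp_Suc_D2[OF b(2)] assms(3) by (auto simp: Domainp_iff)
qed

lemma relpowp_prefix:
  fixes R :: "'a \<Rightarrow> 'a \<Rightarrow> bool"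
  assumes "(R ^^ m) a e" "i \<le> m"
  obtains x where "(R ^^ i) a x"
proof -
  obtain k where "m = i + k" using assms(2) by (auto simp: le_iff_add)
  then have "((R ^^ i) OO (R ^^ k)) a e"
    using assms(1) by (simp only: relpowp_add)
  then show ?thesis using that by (rule relcomppE)
qed

text \<open>Injectivity lets both walks be traced back from \<open>x\<close> in lockstep, and
  neither outlasts the other because \<open>a\<close> and \<open>b\<close> have no
  predecessor.\<close>

lemma relpowp_from_source_unique:
  fixes R :: "'a \<Rightarrow> 'a \<Rightarrow> bool"
  assumes "left_unique R" "(R ^^ i) a x" "(R ^^ j) b x" "\<not> Rangep R a" "\<not> Rangep R b"
  shows "i = j \<and> a = b"
  using assms(2,3)
proof (induction i arbitrary: j x)
  case 0
  then show ?case
    using assms(4) by (cases j) auto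
next
  case (Suc i)
  then obtain y where y: "(R ^^ i) a y" "R y x" by auto
  then obtain j' where "j = Suc j'"
    using Suc.prems assms(5) by (cases j) auto
  then show ?case
    using Suc y assms(1) by (auto elim!: relpowp_Suc_E dest: left_uniqueD)
qed

text \<open>\<open>R\<close> and \<open>D\<close> stand for the moves right and down. The
  assumptions are symmetric under exchanging and reversing the two relations, so facts proved for
  \<open>R\<close> transfer to all four directions.\<close>

locale commuting_partial_injections =
  fixes A :: "'a set" and R D :: "'a \<Rightarrow> 'a \<Rightarrow> bool"
  assumes finite: "finite A"
    and R_in: "R x y \<Longrightarrow> x \<in> A \<and> y \<in> A"
    and D_in: "D x y \<Longrightarrow> x \<in> A \<and> y \<in> A"
    and right_unique_R: "right_unique R"
    and left_unique_R: "left_unique R"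
    and right_unique_D: "right_unique D"
    and left_unique_D: "left_unique D"
    and comm: "\<lbrakk>H \<in> {R, R\<inverse>\<inverse>}; V \<in> {D, D\<inverse>\<inverse>}; H x y; V x z\<rbrakk> \<Longrightarrow> \<exists>t. H z t \<and> V y t"
    and conn: "\<lbrakk>x \<in> A; y \<in> A\<rbrakk> \<Longrightarrow> equivclp (sup R D) x y"
begin

lemma swap: "commuting_partial_injections A D R"
proof
  fix H V x y z
  assume "H \<in> {D, D\<inverse>\<inverse>}" "V \<in> {R, R\<inverse>\<inverse>}" "H x y" "V x z"
  then show "\<exists>t. H z t \<and> V y t"
    using comm[of V H x z y] by blast
qed (use finite R_in D_in right_unique_R left_unique_R right_unique_D left_unique_D conn
     in \<open>auto simp: sup_commute\<close>)

lemma converse_left: "commuting_partial_injections A R\<inverse>\<inverse> D"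
proof
  fix H V x y z
  assume "H \<in> {R\<inverse>\<inverse>, R\<inverse>\<inverse>\<inverse>\<inverse>}" "V \<in> {D, D\<inverse>\<inverse>}" "H x y" "V x z"
  then show "\<exists>t. H z t \<and> V y t"
    using comm[of H V x y z] by auto
next
  fix x y
  assume "x \<in> A" "y \<in> A"
  then have "equivclp (sup R D) x y" by (rule conn)
  then show "equivclp (sup R\<inverse>\<inverse> D) x y"
  proof (induction rule: equivclp_induct)
    case (step y z)
    then have "equivclp (sup R\<inverse>\<inverse> D) y z"
      by (auto simp: sup_fun_def)
    with step show ?case by (blast intro: equivclp_trans)
  qed simp
qed (use finite R_in D_in right_unique_R left_unique_R right_unique_D left_unique_D in auto)

section \<open>Transport across commuting squares\<close>

lemma Domainp_R_invariant: "D x z \<Longrightarrow> Domainp R x \<longleftrightarrow> Domainp R z"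
  using comm[of R D x _ z] comm[of R "D\<inverse>\<inverse>" z _ x] by (auto simp: Domainp_iff)

lemma invariant:
  assumes "\<And>x y. R x y \<Longrightarrow> P x \<longleftrightarrow> P y" "\<And>x y. D x y \<Longrightarrow> P x \<longleftrightarrow> P y"
    and "x \<in> A" "y \<in> A" "P x"
  shows "P y"
  using conn[OF assms(3,4)] assms(5)
  by (induction rule: equivclp_induct) (auto dest: assms(1,2))

lemma lift: "\<lbrakk>R x y; (D ^^ j) x z\<rbrakk> \<Longrightarrow> \<exists>t. R z t \<and> (D ^^ j) y t"
proof (induction j arbitrary: z)
  case (Suc j)
  then obtain w where "(D ^^ j) x w" "D w z" by auto
  with Suc obtain t where "R w t" "(D ^^ j) y t" by blast
  then show ?case
    using comm[of R D w t z] \<open>D w z\<close> by auto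
qed simp

lemma Domainp_R_invariant_relpowp: "(D ^^ j) x z \<Longrightarrow> Domainp R x \<longleftrightarrow> Domainp R z"
proof (induction j arbitrary: z)
  case (Suc j)
  then obtain w where "(D ^^ j) x w" "D w z" by auto
  then show ?case
    using Suc.IH Domainp_R_invariant by blast
qed simp

lemma lift_rtranclp: "\<lbrakk>R x y; D\<^sup>*\<^sup>* x z\<rbrakk> \<Longrightarrow> \<exists>t. R z t \<and> D\<^sup>*\<^sup>* y t"
  by (meson lift relpowp_imp_rtranclp rtranclp_imp_relpowp)

lemma lift_grid:
  assumes "(R ^^ i) x y" "(D ^^ j) x z"
  shows "\<exists>t. (R ^^ i) z t \<and> (D ^^ j) y t"
  using assms
proof (induction i arbitrary: y)
  case (Suc i)
  then obtain w where "(R ^^ i) x w" "R w y" by auto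
  with Suc obtain t where "(R ^^ i) z t" "(D ^^ j) w t" by blast
  moreover obtain t' where "R t t'" "(D ^^ j) y t'"
    using lift[OF \<open>R w y\<close> \<open>(D ^^ j) w t\<close>] by blast
  ultimately show ?case by auto
qed simp

section \<open>Rows that end and rows that close up\<close>

definition terminates :: "'a \<Rightarrow> bool" where
  "terminates x \<longleftrightarrow> (\<exists>e. R\<^sup>*\<^sup>* x e \<and> \<not> Domainp R e)"

lemma terminates_invariant_R:
  assumes "R x y"
  shows "terminates x \<longleftrightarrow> terminates y"
proof
  assume "terminates x"
  then obtain e where e: "R\<^sup>*\<^sup>* x e" "\<not> Domainp R e"
    unfolding terminates_def by blast
  from e(1) show "terminates y"
  proof (cases rule: converse_rtranclpE)
    case base
    then show ?thesis using assms e by blast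
  next
    case (step z)
    then show ?thesis
      using assms e right_uniqueD[OF right_unique_R] unfolding terminates_def by blast
  qed
next
  assume "terminates y"
  then show "terminates x"
    using assms unfolding terminates_def by (meson converse_rtranclp_into_rtranclp)
qed

text \<open>Commuting squares carry the walk to the end \<open>e\<close> over to the row of
  \<open>z\<close>; its image is again an end, since having a right neighbour is invariant along
  \<open>D\<close>.\<close>

lemma terminates_along_D:
  assumes "D x z" "terminates x"
  shows "terminates z"
proof -
  interpret swap: commuting_partial_injections A D R by (rule swap)
  from assms(2) obtain e where "R\<^sup>*\<^sup>* x e" "\<not> Domainp R e"
    unfolding terminates_def by blast
  then show ?thesis
    using swap.lift_rtranclp[OF assms(1)] Domainp_R_invariant unfolding terminates_def by blast
qed

text \<open>Termination is invariant along both relations, so by connectedness one dead end affects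
  every row. The interpretation \<open>up\<close> covers steps against \<open>D\<close>.\<close>

lemma terminates_everywhere:
  assumes "x \<in> A" "\<not> Domainp R x" "y \<in> A"
  shows "terminates y"
proof -
  interpret up: commuting_partial_injections A R "D\<inverse>\<inverse>"
    by (metis swap commuting_partial_injections.swap commuting_partial_injections.converse_left)
  have "terminates x"
    using assms(2) unfolding terminates_def by blast
  then show ?thesis
    using invariant[of terminates, OF terminates_invariant_R _ assms(1,3)]
      terminates_along_D up.terminates_along_D by blast
qed

text \<open>The successor function is injective on the finite forward orbit of \<open>y\<close>,
  hence onto; so \<open>y\<close> has a predecessor in that orbit, which must be
  \<open>x\<close>.\<close>

lemma total_imp_cyclic:
  assumes "\<And>x. x \<in> A \<Longrightarrow> Domainp R x" "R x y"
  shows "R\<^sup>*\<^sup>* y x"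
proof -
  obtain r where r: "\<And>x. x \<in> A \<Longrightarrow> R x (r x)"
    using assms(1) unfolding Domainp_iff by metis
  let ?S = "{z. R\<^sup>*\<^sup>* y z}"
  have SA: "?S \<subseteq> A"
  proof
    fix z assume "z \<in> ?S"
    then have "R\<^sup>*\<^sup>* y z" by simp
    then show "z \<in> A"
      by (cases rule: rtranclp.cases) (use assms(2) R_in in blast)+
  qed
  have "r ` ?S = ?S"
  proof (rule endo_inj_surj)
    show "finite ?S" using SA finite by (rule finite_subset)
    show "r ` ?S \<subseteq> ?S" using r SA by (auto intro: rtranclp.rtrancl_into_rtrancl)
    show "inj_on r ?S"
    proof (rule inj_onI)
      fix u v assume "u \<in> ?S" "v \<in> ?S" "r u = r v"
      then show "u = v"
        using r[of u] r[of v] SA left_uniqueD[OF left_unique_R, of u "r u" v] by auto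
    qed
  qed
  then obtain s where "s \<in> ?S" "y = r s" by blast
  then show ?thesis
    using r SA assms(2) left_uniqueD[OF left_unique_R, of x y s] by auto
qed

text \<open>The converse of \<open>R\<close> is total, so its rows are cycles, and a cycle entering
  \<open>x\<close> also leaves it.\<close>

lemma surjective_imp_total:
  assumes "\<And>x. x \<in> A \<Longrightarrow> Rangep R x" "x \<in> A"
  shows "Domainp R x"
proof -
  interpret left: commuting_partial_injections A "R\<inverse>\<inverse>" D by (rule converse_left)
  obtain y where y: "R y x" using assms by (auto simp: Rangep.simps)
  then have "(R\<inverse>\<inverse>)\<^sup>*\<^sup>* y x"
    using left.total_imp_cyclic[of x y] assms(1) by (auto simp: Domainp.simps Rangep.simps)
  then have "R\<^sup>*\<^sup>* x y" by (simp add: rtranclp_conversep)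
  then show ?thesis
    using y by (cases rule: converse_rtranclpE) auto
qed

text \<open>Some element lacks a right neighbour, so by \<open>surjective_imp_total\<close> some
  element lacks a left one. Then every leftward walk ends, in particular the one from
  \<open>a\<close>.\<close>

lemma ex_source:
  assumes "\<not> (\<forall>x \<in> A. Domainp R x)" "a \<in> A"
  shows "\<exists>b \<in> A. R\<^sup>*\<^sup>* b a \<and> \<not> Rangep R b"
proof -
  interpret left: commuting_partial_injections A "R\<inverse>\<inverse>" D by (rule converse_left)
  obtain z where "z \<in> A" "\<not> Domainp R\<inverse>\<inverse> z"
    using surjective_imp_total assms(1) by (metis Domainp_conversep)
  then obtain b where b: "(R\<inverse>\<inverse>)\<^sup>*\<^sup>* a b" "\<not> Rangep R b"
    using left.terminates_everywhere[OF _ _ assms(2)]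
    unfolding left.terminates_def Domainp_conversep by blast
  have "b \<in> A"
    using b(1) assms(2) by (cases rule: rtranclp.cases) (auto dest: R_in)
  with b show ?thesis by (auto simp: rtranclp_conversep)
qed

section \<open>A counter cannot run along cyclic rows\<close>

lemma rtranclp_change:
  assumes "R\<^sup>*\<^sup>* a b" "\<not> B a" "B b"
  shows "\<exists>u u'. R\<^sup>*\<^sup>* a u \<and> R u u' \<and> \<not> B u \<and> B u'"
  using assms(1,3)
proof (induction rule: rtranclp_induct)
  case base
  then show ?case using assms(2) by simp
next
  case (step u u')
  then show ?case by blast
qed

text \<open>An abstract form of the counter axioms that serves both counters: \<open>R\<close> runs
  along a cyclic row of bits, \<open>D\<close> leads to the next row. A rise from false to true is
  passed on from a first row to a last one, where all bits are false.\<close>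

lemma no_cyclic_counter:
  assumes total: "\<And>x. x \<in> A \<Longrightarrow> Domainp R x"
    and not_total: "\<not> (\<forall>x \<in> A. Domainp D x)"
    and first: "\<And>x y. \<lbrakk>\<not> Rangep D x; R x y\<rbrakk> \<Longrightarrow> B x \<noteq> B y"
    and carry: "\<And>x y u v. \<lbrakk>D u x; R x y; R u v; \<not> B u; B v\<rbrakk> \<Longrightarrow> B x \<noteq> B y"
    and last: "\<And>x. \<lbrakk>x \<in> A; \<not> Domainp D x\<rbrakk> \<Longrightarrow> \<not> B x"
  shows False
proof -
  interpret swap: commuting_partial_injections A D R by (rule swap)
  \<comment> \<open>The row of \<open>z\<close> contains a rise. A mere change of bit would not
    suffice to apply \<open>carry\<close>.\<close>
  define P where "P z \<longleftrightarrow> (\<exists>u u'. R\<^sup>*\<^sup>* z u \<and> R u u' \<and> \<not> B u \<and> B u')" for z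
  have P_intro: "P z" if w: "R\<^sup>*\<^sup>* z w" "R w w'" "B w \<noteq> B w'" for z w w'
  proof (cases "B w")
    \<comment> \<open>The bit falls from \<open>w\<close> to \<open>w'\<close>, so it must rise
      somewhere on the way round the cycle back to \<open>w\<close>.\<close>
    case True
    then obtain u u' where "R\<^sup>*\<^sup>* w' u" "R u u'" "\<not> B u" "B u'"
      using rtranclp_change[of w' w B] total_imp_cyclic[OF total w(2)] w(3) by auto
    then show ?thesis
      using w(1,2) unfolding P_def by (meson rtranclp.rtrancl_into_rtrancl rtranclp_trans)
  next
    case False
    then show ?thesis using w unfolding P_def by blast
  qed
  obtain x where x: "x \<in> A" "\<not> Domainp D x" using not_total by blast
  obtain s where s: "s \<in> A" "D\<^sup>*\<^sup>* s x" "\<not> Rangep D s"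
    using swap.ex_source[OF not_total x(1)] by blast
  from s(2) have "P x"
  proof (induction rule: rtranclp_induct)
    case base
    show ?case
      using total[OF s(1)] first[OF s(3)] by (auto simp: Domainp_iff intro: P_intro)
  next
    case (step y z)
    then obtain u u' where u: "R\<^sup>*\<^sup>* y u" "R u u'" "\<not> B u" "B u'"
      unfolding P_def by blast
    obtain w where w: "D u w" "R\<^sup>*\<^sup>* z w"
      using swap.lift_rtranclp[OF step(2) u(1)] by blast
    obtain w' where w': "R w w'"
      using lift[OF u(2), of 1 w] w(1) by auto
    show ?case
      using P_intro[OF w(2) w' carry[OF w(1) w' u(2-4)]] .
  qed
  then obtain u u' where u: "R\<^sup>*\<^sup>* x u" "R u u'" "B u'"
    unfolding P_def by blast
  from u(1,2) have "R\<^sup>*\<^sup>* x u'" by (rule rtranclp.rtrancl_into_rtrancl)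
  \<comment> \<open>The rise may lie anywhere in the row of \<open>x\<close>, so being in the last
    row is transferred along the row to \<open>u'\<close>.\<close>
  then have "Domainp D u' \<longleftrightarrow> Domainp D x"
    by (meson rtranclp_imp_relpowp swap.Domainp_R_invariant_relpowp)
  then show False
    using last[of u'] x(2) u(3) R_in[OF u(2)] by simp
qed

section \<open>Unrolling a torus\<close>

lemma ex_period:
  assumes "\<And>x. x \<in> A \<Longrightarrow> R x (r x)" "v \<in> A"
  shows "\<exists>N>0. (r ^^ N) v = v"
proof -
  have "R\<^sup>*\<^sup>* (r v) v"
  proof (rule total_imp_cyclic)
    show "Domainp R x" if "x \<in> A" for x using assms(1)[OF that] by blast
    show "R v (r v)" using assms by blast
  qed
  then obtain n where n: "(R ^^ n) (r v) v" using rtranclp_imp_relpowp by metis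
  have "y = (r ^^ k) x" if "(R ^^ k) x y" for k x y
    using that
  proof (induction k arbitrary: y)
    case (Suc k)
    then obtain z where "(R ^^ k) x z" "R z y" by auto
    then show ?case
      using Suc.IH[of z] assms(1)[of z] R_in right_uniqueD[OF right_unique_R, of z y "r z"] by auto
  qed simp
  then have "(r ^^ n) (r v) = v" using n by simp
  then have "(r ^^ Suc n) v = v" by (simp add: funpow_swap1)
  then show ?thesis by blast
qed

text \<open>The successor functions \<open>r\<close> and \<open>d\<close> commute, so the plane can
  be wrapped around the torus through \<open>v\<close> and the tiles pulled back.\<close>

lemma periodic_tiling:
  assumes R_total: "\<And>x. x \<in> A \<Longrightarrow> Domainp R x"
    and D_total: "\<And>x. x \<in> A \<Longrightarrow> Domainp D x"
    and "v \<in> A"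
    and T: "\<And>x. x \<in> A \<Longrightarrow> T x \<in> K" "\<And>x y. R x y \<Longrightarrow> (T x, T y) \<in> TR"
      "\<And>x y. D x y \<Longrightarrow> (T x, T y) \<in> TD"
  shows "\<exists>C. is_tiling K TR TD C \<and> periodic C"
proof -
  interpret swap: commuting_partial_injections A D R by (rule swap)
  obtain r where r: "\<And>x. x \<in> A \<Longrightarrow> R x (r x)"
    using R_total unfolding Domainp_iff by metis
  obtain d where d: "\<And>x. x \<in> A \<Longrightarrow> D x (d x)"
    using D_total unfolding Domainp_iff by metis
  obtain N where N: "N > 0" "(r ^^ N) v = v" using ex_period[OF r \<open>v \<in> A\<close>] by blast
  obtain M where M: "M > 0" "(d ^^ M) v = v" using swap.ex_period[OF d \<open>v \<in> A\<close>] by blast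
  have r_in: "(r ^^ i) x \<in> A" if "x \<in> A" for i x
    using that by (induction i) (auto dest!: r R_in)
  have d_in: "(d ^^ i) x \<in> A" if "x \<in> A" for i x
    using that by (induction i) (auto dest!: d D_in)
  have rd: "r (d x) = d (r x)" if "x \<in> A" for x
  proof -
    obtain t where "R (d x) t" "D (r x) t"
      using comm[of R D x "r x" "d x"] r d \<open>x \<in> A\<close> by auto
    then show ?thesis
      using r d R_in D_in right_uniqueD[OF right_unique_R] right_uniqueD[OF right_unique_D]
      by metis
  qed
  have rd': "(r ^^ i) (d x) = d ((r ^^ i) x)" if "x \<in> A" for i x
    using that by (induction i) (auto simp: rd r_in)
  have rd'': "(r ^^ i) ((d ^^ j) x) = (d ^^ j) ((r ^^ i) x)" if "x \<in> A" for i j x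
    using that by (induction j) (auto simp: rd' d_in)
  \<comment> \<open>The successor is respected even where the residue wraps to 0, because
    \<open>f ^^ N\<close> fixes \<open>w\<close>.\<close>
  have step: "(f ^^ nat ((x + 1) mod int N)) w = f ((f ^^ nat (x mod int N)) w)"
    if "N > 0" "(f ^^ N) w = w" for f :: "'a \<Rightarrow> 'a" and N x w
  proof -
    define k where "k = nat (x mod int N)"
    have k: "x mod int N = int k"
      using that(1) by (simp add: k_def)
    have "(x + 1) mod int N = (int k + 1) mod int N"
      by (simp add: mod_add_left_eq flip: k)
    also have "\<dots> = int (Suc k mod N)"
      by (simp add: zmod_int add.commute)
    finally show ?thesis
      using funpow_mod_eq[OF that(2), of "Suc k"] by (simp add: k)
  qed
  \<comment> \<open>Residues are nonnegative, so negative coordinates also give natural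
    exponents.\<close>
  define P where "P x y = (r ^^ nat (x mod int N)) ((d ^^ nat (y mod int M)) v)" for x y
  have P_in: "P x y \<in> A" for x y
    unfolding P_def using \<open>v \<in> A\<close> by (intro r_in d_in)
  \<comment> \<open>By \<open>rd''\<close>, \<open>N\<close> is an \<open>r\<close>-period of every
    \<open>(d ^^ j) v\<close>, not only of \<open>v\<close>.\<close>
  have "P (x + 1) y = r (P x y)" for x y
    unfolding P_def using \<open>v \<in> A\<close> N by (intro step) (auto simp: rd'')
  moreover have "P x (y + 1) = d (P x y)" for x y
    unfolding P_def using \<open>v \<in> A\<close> M by (simp add: step rd' d_in)
  ultimately have "is_tiling K TR TD (\<lambda>(x, y). T (P x y))"
    unfolding is_tiling_def using T r d P_in by simp
  moreover have "P x y = P (x + int N) y" for x y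
    unfolding P_def by simp
  then have "periodic (\<lambda>(x, y). T (P x y))"
    unfolding periodic_def using N(1) by (intro exI[of _ "int N"] exI[of _ 0]) simp
  ultimately show ?thesis by blast
qed

end

section \<open>Coordinates\<close>

context commuting_partial_injections
begin

definition at :: "'a \<Rightarrow> nat \<Rightarrow> nat \<Rightarrow> 'a \<Rightarrow> bool" where
  "at c i j x \<longleftrightarrow> (\<exists>y. (R ^^ i) c y \<and> (D ^^ j) y x)"

text \<open>The new edge has to be inserted before the vertical part of the path: it is found at
  \<open>y\<close>, pushed down to \<open>x\<close>, and uniqueness identifies its endpoint with
  \<open>x'\<close>.\<close>

lemma at_right:
  assumes "at c i j x" "R x x'"
  shows "at c (Suc i) j x'"
proof -
  obtain y where y: "(R ^^ i) c y" "(D ^^ j) y x"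
    using assms(1) unfolding at_def by blast
  obtain y' where y': "R y y'"
    using Domainp_R_invariant_relpowp[OF y(2)] assms(2) by auto
  then obtain t where t: "R x t" "(D ^^ j) y' t"
    using lift[OF _ y(2)] by blast
  have "t = x'"
    using right_uniqueD[OF right_unique_R t(1) assms(2)] .
  then show ?thesis
    using relpowp_Suc_I[OF y(1) y'] t(2) unfolding at_def by blast
qed

lemma at_down: "\<lbrakk>at c i j x; D x x'\<rbrakk> \<Longrightarrow> at c i (Suc j) x'"
  unfolding at_def by auto

lemma at_SucE_right:
  assumes "at c (Suc i) j x'"
  obtains x where "at c i j x" "R x x'"
proof -
  interpret left: commuting_partial_injections A "R\<inverse>\<inverse>" D by (rule converse_left)
  obtain y y' where y: "(R ^^ i) c y" "R y y'" "(D ^^ j) y' x'"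
    using assms unfolding at_def by auto
  then obtain t where "R t x'" "(D ^^ j) y t"
    using left.lift[of y' y j x'] by auto
  then show ?thesis
    using that y(1) unfolding at_def by blast
qed

lemma at_SucE_down:
  assumes "at c i (Suc j) x'"
  obtains x where "at c i j x" "D x x'"
  using assms that unfolding at_def by auto

end

text \<open>\<open>c\<close> is the top left corner, \<open>e\<close> the right end of its row and
  \<open>e'\<close> the bottom of its column. \<open>m\<close> and \<open>n\<close> count steps, so
  they are the largest coordinates and not numbers of elements.\<close>

locale grid = commuting_partial_injections +
  fixes c :: 'a and m n :: nat and e e' :: 'a
  assumes c: "c \<in> A" "\<not> Rangep R c" "\<not> Rangep D c"
    and e: "(R ^^ m) c e" "\<not> Domainp R e"
    and e': "(D ^^ n) c e'" "\<not> Domainp D e'"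
begin

section \<open>Uniqueness, existence and bounds of coordinates\<close>

lemma boundary_invariant:
  shows "(D ^^ j) x z \<Longrightarrow> Rangep R x \<longleftrightarrow> Rangep R z"
    and "(R ^^ j) x z \<Longrightarrow> Rangep D x \<longleftrightarrow> Rangep D z"
    and "(R ^^ j) x z \<Longrightarrow> Domainp D x \<longleftrightarrow> Domainp D z"
proof -
  interpret left: commuting_partial_injections A "R\<inverse>\<inverse>" D by (rule converse_left)
  interpret swap: commuting_partial_injections A D R by (rule swap)
  interpret up: commuting_partial_injections A "D\<inverse>\<inverse>" R by (rule swap.converse_left)
  show "(D ^^ j) x z \<Longrightarrow> Rangep R x \<longleftrightarrow> Rangep R z"
    using left.Domainp_R_invariant_relpowp[of j x z] by simp
  show "(R ^^ j) x z \<Longrightarrow> Rangep D x \<longleftrightarrow> Rangep D z"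
    using up.Domainp_R_invariant_relpowp[of j x z] by simp
  show "(R ^^ j) x z \<Longrightarrow> Domainp D x \<longleftrightarrow> Domainp D z"
    by (rule swap.Domainp_R_invariant_relpowp)
qed

text \<open>Going up from \<open>x\<close> can only stop in the top row, and going left from there
  only at \<open>c\<close>; this fixes both lengths.\<close>

lemma at_unique_index:
  assumes "at c i j x" "at c i' j' x"
  shows "i = i' \<and> j = j'"
proof -
  obtain y y' where y: "(R ^^ i) c y" "(D ^^ j) y x" "(R ^^ i') c y'" "(D ^^ j') y' x"
    using assms unfolding at_def by blast
  have "\<not> Rangep D y" "\<not> Rangep D y'"
    using c(3) boundary_invariant(2)[OF y(1)] boundary_invariant(2)[OF y(3)] by simp_all
  then have "j = j' \<and> y = y'"
    by (rule relpowp_from_source_unique[OF left_unique_D y(2,4)])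
  then show ?thesis
    using c(2) relpowp_from_source_unique[OF left_unique_R y(1), of i' c] y(3) by simp
qed

lemma at_unique:
  assumes "at c i j x" "at c i j y"
  shows "x = y"
proof -
  obtain x' y' where *: "(R ^^ i) c x'" "(D ^^ j) x' x" "(R ^^ i) c y'" "(D ^^ j) y' y"
    using assms unfolding at_def by blast
  have "x' = y'"
    using relpowp_right_uniqueD[OF right_unique_R *(1,3)] .
  then show ?thesis
    using relpowp_right_uniqueD[OF right_unique_D *(2)] *(4) by simp
qed

lemma not_Rangep_at:
  shows "at c 0 j x \<Longrightarrow> \<not> Rangep R x" and "at c i 0 x \<Longrightarrow> \<not> Rangep D x"
  using c boundary_invariant by (auto simp: at_def)

text \<open>Having coordinates is preserved by moves in all four directions. Moves left and up need
  a positive index, which holds because index 0 excludes a predecessor.\<close>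

lemma ex_at:
  assumes "x \<in> A"
  shows "\<exists>i j. at c i j x"
proof (rule invariant[where P = "\<lambda>x. \<exists>i j. at c i j x", OF _ _ c(1) assms])
  show "\<exists>i j. at c i j c"
    unfolding at_def by (intro exI[of _ 0]) auto
next
  fix x y assume "R x y"
  show "(\<exists>i j. at c i j x) \<longleftrightarrow> (\<exists>i j. at c i j y)"
  proof
    assume "\<exists>i j. at c i j y"
    then obtain i j where ij: "at c i j y" by blast
    with \<open>R x y\<close> obtain i' where "i = Suc i'"
      using not_Rangep_at(1) by (cases i) auto
    then have "at c (Suc i') j y"
      using ij by simp
    then obtain w where w: "at c i' j w" "R w y" by (rule at_SucE_right)
    then show "\<exists>i j. at c i j x"
      using left_uniqueD[OF left_unique_R w(2) \<open>R x y\<close>] by blast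
  qed (use at_right[OF _ \<open>R x y\<close>] in metis)
next
  fix x y assume "D x y"
  show "(\<exists>i j. at c i j x) \<longleftrightarrow> (\<exists>i j. at c i j y)"
  proof
    assume "\<exists>i j. at c i j y"
    then obtain i j where ij: "at c i j y" by blast
    with \<open>D x y\<close> obtain j' where "j = Suc j'"
      using not_Rangep_at(2) by (cases j) auto
    then have "at c i (Suc j') y"
      using ij by simp
    then obtain w where w: "at c i j' w" "D w y" by (rule at_SucE_down)
    then show "\<exists>i j. at c i j x"
      using left_uniqueD[OF left_unique_D w(2) \<open>D x y\<close>] by blast
  qed (use at_down[OF _ \<open>D x y\<close>] in metis)
qed

text \<open>All columns have the height of the first: the row segment to \<open>y\<close> is
  transported down to \<open>e'\<close>, and lying on the bottom border is invariant along
  rows.\<close>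

lemma last_in_column:
  assumes "(R ^^ i) c y"
  obtains t where "(D ^^ n) y t" "\<not> Domainp D t"
proof -
  obtain t where t: "(R ^^ i) e' t" "(D ^^ n) y t"
    using lift_grid[OF assms e'(1)] by blast
  show ?thesis
    using that[OF t(2)] boundary_invariant(3)[OF t(1)] e'(2) by simp
qed

lemma at_bounds:
  assumes "at c i j x"
  shows "i \<le> m \<and> j \<le> n"
proof -
  obtain y where y: "(R ^^ i) c y" "(D ^^ j) y x"
    using assms unfolding at_def by blast
  obtain t where t: "(D ^^ n) y t" "\<not> Domainp D t"
    using last_in_column[OF y(1)] .
  show ?thesis
    using relpowp_maximal[OF right_unique_R e y(1)] relpowp_maximal[OF right_unique_D t y(2)]
    by simp
qed

lemma at_exists:
  assumes "i \<le> m" "j \<le> n"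
  shows "\<exists>x \<in> A. at c i j x"
proof -
  obtain y where y: "(R ^^ i) c y" using relpowp_prefix[OF e(1) assms(1)] .
  obtain t where t: "(D ^^ n) y t" using last_in_column[OF y] .
  obtain x where x: "(D ^^ j) y x" using relpowp_prefix[OF t assms(2)] .
  have in_A: "v \<in> A" if "u \<in> A" "(S ^^ k) u v" "S = R \<or> S = D" for u v k S
    using that R_in D_in by (cases k) auto
  have "y \<in> A"
    using in_A[OF c(1) y] by simp
  then have "x \<in> A"
    using in_A[OF _ x] by simp
  then show ?thesis
    using x y unfolding at_def by blast
qed

text \<open>Coordinates give the bijection. They also determine the edges, since an element with a
  positive index has a predecessor whose coordinates identify it.\<close>

lemma isomorphic_rect_grid:
  "lrud_isomorphic \<lparr>universe = A, relL = R\<inverse>\<inverse>, relR = R, relU = D\<inverse>\<inverse>, relD = D\<rparr>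
     (rect_grid (int m) (int n))"
proof -
  obtain p q where pq: "\<And>x. x \<in> A \<Longrightarrow> at c (p x) (q x) x"
    using ex_at by metis
  have pqI: "p x = i \<and> q x = j" if "x \<in> A" "at c i j x" for x i j
    using at_unique_index[OF pq[OF that(1)] that(2)] .
  define f where "f x = (int (p x), int (q x))" for x
  have R_iff: "R x y \<longleftrightarrow> p y = Suc (p x) \<and> q y = q x" if "x \<in> A" "y \<in> A" for x y
  proof
    assume "R x y"
    then show "p y = Suc (p x) \<and> q y = q x"
      using pqI[OF that(2)] at_right[OF pq[OF that(1)]] by blast
  next
    assume "p y = Suc (p x) \<and> q y = q x"
    then have "at c (Suc (p x)) (q x) y"
      using pq[OF that(2)] by simp
    then obtain w where "at c (p x) (q x) w" "R w y" by (rule at_SucE_right)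
    then show "R x y"
      using at_unique[OF pq[OF that(1)], of w] by simp
  qed
  have D_iff: "D x y \<longleftrightarrow> p y = p x \<and> q y = Suc (q x)" if "x \<in> A" "y \<in> A" for x y
  proof
    assume "D x y"
    then show "p y = p x \<and> q y = Suc (q x)"
      using pqI[OF that(2)] at_down[OF pq[OF that(1)]] by blast
  next
    assume "p y = p x \<and> q y = Suc (q x)"
    then have "at c (p x) (Suc (q x)) y"
      using pq[OF that(2)] by simp
    then obtain w where "at c (p x) (q x) w" "D w y" by (rule at_SucE_down)
    then show "D x y"
      using at_unique[OF pq[OF that(1)], of w] by simp
  qed
  have bounds: "p x \<le> m \<and> q x \<le> n" if "x \<in> A" for x
    using at_bounds[OF pq[OF that]] .
  have "bij_betw f A ({0..int m} \<times> {0..int n})"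
    unfolding bij_betw_def
  proof
    show "inj_on f A"
      unfolding f_def by (rule inj_onI) (metis at_unique pq prod.inject of_nat_eq_iff)
    show "f ` A = {0..int m} \<times> {0..int n}"
    proof
      show "f ` A \<subseteq> {0..int m} \<times> {0..int n}"
        using bounds by (auto simp: f_def)
      show "{0..int m} \<times> {0..int n} \<subseteq> f ` A"
      proof
        fix w assume "w \<in> {0..int m} \<times> {0..int n}"
        then obtain i j where w: "w = (int i, int j)" "i \<le> m" "j \<le> n"
          by (metis SigmaE atLeastAtMost_iff nonneg_int_cases of_nat_le_iff)
        then obtain x where "x \<in> A" "at c i j x" using at_exists by blast
        then show "w \<in> f ` A" using pqI w(1) by (force simp: f_def)
      qed
    qed
  qed
  then show ?thesis
    unfolding lrud_isomorphic_def rect_grid_def Let_def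
    by (intro exI[of _ f]) (auto simp: f_def R_iff D_iff bounds)
qed

end

text \<open>The corner is reached by walking left to an end \<open>b\<close> and then up to
  \<open>c\<close>; the absence of a left neighbour is invariant on the way up.\<close>

lemma (in commuting_partial_injections) terminating_imp_grid:
  assumes "x \<in> A" "\<not> (\<forall>x \<in> A. Domainp R x)" "\<not> (\<forall>x \<in> A. Domainp D x)"
  shows "\<exists>m n. lrud_isomorphic
    \<lparr>universe = A, relL = R\<inverse>\<inverse>, relR = R, relU = D\<inverse>\<inverse>, relD = D\<rparr> (rect_grid (int m) (int n))"
proof -
  interpret left: commuting_partial_injections A "R\<inverse>\<inverse>" D by (rule converse_left)
  interpret swap: commuting_partial_injections A D R by (rule swap)
  obtain b where b: "b \<in> A" "\<not> Rangep R b"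
    using ex_source[OF assms(2,1)] by blast
  obtain c where c: "c \<in> A" "D\<^sup>*\<^sup>* c b" "\<not> Rangep D c"
    using swap.ex_source[OF assms(3) b(1)] by blast
  obtain j where "(D ^^ j) c b"
    using rtranclp_imp_relpowp[OF c(2)] by blast
  then have "\<not> Rangep R c"
    using b(2) left.Domainp_R_invariant_relpowp[of j c b] by simp
  moreover obtain m e where "(R ^^ m) c e" "\<not> Domainp R e"
    using terminates_everywhere[OF _ _ c(1)] assms(2) rtranclp_imp_relpowp
    unfolding terminates_def by metis
  moreover obtain n e' where "(D ^^ n) c e'" "\<not> Domainp D e'"
    using swap.terminates_everywhere[OF _ _ c(1)] assms(3) rtranclp_imp_relpowp
    unfolding swap.terminates_def by metis
  ultimately interpret grid A R D c m n e e'
    using c by unfold_locales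
  show ?thesis using isomorphic_rect_grid by blast
qed

section \<open>Models of the axioms\<close>

theorem theorem3:
  fixes K :: "'k set" and TR TD :: "('k \<times> 'k) set" and G :: "('a, 'k) tile_struct"
  assumes "finite K" and "TR \<subseteq> K \<times> K" and "TD \<subseteq> K \<times> K"
    and "\<exists>C. is_tiling K TR TD C"
    and "\<not> (\<exists>C. is_tiling K TR TD C \<and> periodic C)"
    and "is_model_phi2 K TR TD G"
    and "finite (universe G)"
    and "gaifman_connected (lrud_reduct G)"
  shows "\<exists>m n. m \<ge> 0 \<and> n \<ge> 0 \<and> lrud_isomorphic (lrud_reduct G) (rect_grid m n)"
proof -
  let ?A = "universe G" and ?R = "relR G" and ?D = "relD G"
  have struct: "is_structure K G" and pf: "partial_functionality G" and inv: "inverses G"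
    and com: "commutativity G" and hc: "horizontal_counter G" and vc: "vertical_counter G"
    and ft: "full_tiling K G" and ct: "correct_tiling K TR TD G"
    using assms(6) by (auto simp: is_model_phi2_def phi2_def phi1_def)
  have in_A: "x \<in> ?A \<and> y \<in> ?A" if "X x y" "X \<in> {relL G, relR G, relU G, relD G}" for X x y
  proof -
    have "\<forall>X \<in> {relL G, relR G, relU G, relD G}. \<forall>x y. X x y \<longrightarrow> x \<in> ?A \<and> y \<in> ?A"
      using struct unfolding is_structure_def by (elim conjE)
    from bspec[OF this that(2)] that(1) show ?thesis by blast
  qed
  have L: "relL G = ?R\<inverse>\<inverse>" and U: "relU G = ?D\<inverse>\<inverse>"
  proof -
    have "relL G x y \<longleftrightarrow> ?R y x" for x y
      using inv in_A[of "relL G" x y] in_A[of ?R y x] unfolding inverses_def by blast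
    moreover have "relU G x y \<longleftrightarrow> ?D y x" for x y
      using inv in_A[of "relU G" x y] in_A[of ?D y x] unfolding inverses_def by blast
    ultimately show "relL G = ?R\<inverse>\<inverse>" "relU G = ?D\<inverse>\<inverse>"
      by (simp_all add: fun_eq_iff)
  qed
  have func: "y = z" if "X x y" "X x z" "X \<in> {relL G, relR G, relU G, relD G}" for X x y z
    using pf that in_A[OF that(1,3)] in_A[OF that(2,3)] unfolding partial_functionality_def by metis
  have defined: "defined_at G X x \<longleftrightarrow> Domainp X x"
    and holds: "holds_at G X P x \<longleftrightarrow> (\<exists>y. X x y \<and> P y)"
    if "X \<in> {relL G, relR G, relU G, relD G}" for X x P
    using in_A[OF _ that] by (auto simp: defined_at_def holds_at_def)
  interpret commuting_partial_injections ?A ?R ?D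
  proof
    show "finite ?A" by fact
    show "?R x y \<Longrightarrow> x \<in> ?A \<and> y \<in> ?A" "?D x y \<Longrightarrow> x \<in> ?A \<and> y \<in> ?A" for x y
      using in_A by blast+
    show "right_unique ?R" "right_unique ?D"
      using func by (auto intro!: right_uniqueI)
    show "left_unique ?R" "left_unique ?D"
      using func[of "relL G"] func[of "relU G"] by (auto intro!: left_uniqueI simp: L U)
  next
    fix H V x y z
    assume *: "H \<in> {?R, ?R\<inverse>\<inverse>}" "V \<in> {?D, ?D\<inverse>\<inverse>}" "H x y" "V x z"
    then have HV: "H \<in> {relL G, relR G}" "V \<in> {relU G, relD G}"
      unfolding L U by auto
    then have "x \<in> ?A" "y \<in> ?A" "z \<in> ?A"
      using *(3,4) in_A by blast+
    then show "\<exists>t. H z t \<and> V y t"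
      using com HV *(3,4) unfolding commutativity_def by blast
  next
    fix x y assume "x \<in> ?A" "y \<in> ?A"
    then have "(gaifman_adj (lrud_reduct G))\<^sup>*\<^sup>* x y"
      using assms(8) by (simp add: gaifman_connected_def lrud_struct.truncate_def)
    then show "equivclp (sup ?R ?D) x y"
    proof (induction rule: rtranclp_induct)
      case (step y z)
      then have "equivclp (sup ?R ?D) y z"
        by (auto simp: gaifman_adj_def lrud_struct.truncate_def L U)
      with step show ?case by (blast intro: equivclp_trans)
    qed simp
  qed
  interpret swap: commuting_partial_injections ?A ?D ?R by (rule swap)
  interpret up: commuting_partial_injections ?A "?D\<inverse>\<inverse>" ?R by (rule swap.converse_left)
  interpret up': commuting_partial_injections ?A ?R "?D\<inverse>\<inverse>" by (rule up.swap)
  obtain v where v: "v \<in> ?A" using struct unfolding is_structure_def by blast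
  have flip_H: "BH G x \<noteq> BH G y \<longleftrightarrow> carry_vertical G x" if "?R x y" for x y
  proof -
    have "holds_at G ?R (BH G) x \<longleftrightarrow> BH G y" "defined_at G ?R x"
      using that func[of ?R x] by (auto simp: holds defined)
    moreover have "x \<in> ?A"
      using in_A[of ?R x y] that by simp
    ultimately show ?thesis
      using vc unfolding vertical_counter_def by metis
  qed
  have flip_V: "BV G x \<noteq> BV G y \<longleftrightarrow> carry_horizontal G x" if "?D\<inverse>\<inverse> x y" for x y
  proof -
    have "holds_at G (relU G) (BV G) x \<longleftrightarrow> BV G y" "defined_at G (relU G) x"
      using that func[of "relU G" x] by (auto simp: holds defined U)
    moreover have "x \<in> ?A"
      using in_A[of ?D y x] that by simp
    ultimately show ?thesis
      using hc unfolding horizontal_counter_def by metis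
  qed
  have "\<not> ((\<forall>x \<in> ?A. Domainp ?R x) \<and> (\<forall>x \<in> ?A. Domainp ?D x))"
  proof
    assume total: "(\<forall>x \<in> ?A. Domainp ?R x) \<and> (\<forall>x \<in> ?A. Domainp ?D x)"
    obtain T where T: "\<And>x. x \<in> ?A \<Longrightarrow> T x \<in> K \<and> tile G (T x) x"
      using ft unfolding full_tiling_def by metis
    have "(T x, T y) \<in> TR" if "?R x y" for x y
    proof -
      have "x \<in> ?A" "y \<in> ?A"
        using in_A[of ?R x y] that by simp_all
      moreover from this have "holds_at G ?R (tile G (T y)) x"
        using that T by (auto simp: holds)
      ultimately show ?thesis
        using ct T unfolding correct_tiling_def by metis
    qed
    moreover have "(T x, T y) \<in> TD" if "?D x y" for x y
    proof -
      have "x \<in> ?A" "y \<in> ?A"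
        using in_A[of ?D x y] that by simp_all
      moreover from this have "holds_at G ?D (tile G (T y)) x"
        using that T by (auto simp: holds)
      ultimately show ?thesis
        using ct T unfolding correct_tiling_def by metis
    qed
    ultimately show False
      using periodic_tiling[of v T K TR TD] total v T assms(5) by blast
  qed
  \<comment> \<open>Rows are cyclic and are visited from bottom to top. In the bottom row the
    missing lower neighbour makes \<open>carry_vertical\<close> true, so adjacent bits
    differ.\<close>
  moreover have False if total: "\<forall>x \<in> ?A. Domainp ?R x" and "\<not> (\<forall>x \<in> ?A. Domainp ?D x)"
  proof (rule up'.no_cyclic_counter[where B = "BH G"])
    show "\<not> (\<forall>x \<in> ?A. Domainp ?D\<inverse>\<inverse> x)"
      using that(2) swap.surjective_imp_total unfolding Domainp_conversep by blast
    show "BH G x \<noteq> BH G y" if "\<not> Rangep ?D\<inverse>\<inverse> x" "?R x y" for x y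
      using flip_H that by (simp add: carry_vertical_def defined)
    \<comment> \<open>Here \<open>u\<close> lies below \<open>x\<close>, so the rise from
      \<open>u\<close> to \<open>w\<close> is the second disjunct of
      \<open>carry_vertical\<close>.\<close>
    show "BH G x \<noteq> BH G y"
      if "?D\<inverse>\<inverse> u x" "?R x y" "?R u w" "\<not> BH G u" "BH G w" for x y u w
    proof -
      have "\<not> holds_at G ?D (BH G) x" "holds_at G ?D (holds_at G ?R (BH G)) x"
        using that func[of ?D x] by (auto simp: holds)
      then show ?thesis
        using flip_H[OF that(2)] by (simp add: carry_vertical_def)
    qed
    show "\<not> BH G x" if "x \<in> ?A" "\<not> Domainp ?D\<inverse>\<inverse> x" for x
      using vc that by (auto simp: vertical_counter_def defined U)
  qed (use total in blast)
  \<comment> \<open>Cyclic columns, read upwards, now play the part of the rows; they are visited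
    from the left border to the right border, where \<open>BV\<close> is false.\<close>
  moreover have False if total: "\<forall>x \<in> ?A. Domainp ?D x" and "\<not> (\<forall>x \<in> ?A. Domainp ?R x)"
  proof (rule up.no_cyclic_counter[where B = "BV G"])
    show "Domainp ?D\<inverse>\<inverse> x" if "x \<in> ?A" for x
      using up.surjective_imp_total[OF _ that] total by simp
    show "BV G x \<noteq> BV G y" if "\<not> Rangep ?R x" "?D\<inverse>\<inverse> x y" for x y
      using flip_V that by (simp add: carry_horizontal_def defined L)
    show "BV G x \<noteq> BV G y"
      if "?R u x" "?D\<inverse>\<inverse> x y" "?D\<inverse>\<inverse> u w" "\<not> BV G u" "BV G w" for x y u w
    proof -
      have "\<not> holds_at G (relL G) (BV G) x" "holds_at G (relL G) (holds_at G (relU G) (BV G)) x"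
        using that func[of "relL G" x] by (auto simp: holds L U)
      then show ?thesis
        using flip_V[OF that(2)] by (simp add: carry_horizontal_def)
    qed
    show "\<not> BV G x" if "x \<in> ?A" "\<not> Domainp ?R x" for x
      using hc that by (auto simp: horizontal_counter_def defined)
  qed (use that(2) in blast)
  ultimately obtain m n where
    "lrud_isomorphic \<lparr>universe = ?A, relL = ?R\<inverse>\<inverse>, relR = ?R, relU = ?D\<inverse>\<inverse>, relD = ?D\<rparr>
       (rect_grid (int m) (int n))"
    using terminating_imp_grid[OF v] by blast
  then have "lrud_isomorphic (lrud_reduct G) (rect_grid (int m) (int n))"
    by (simp add: lrud_struct.truncate_def L U)
  then show ?thesis
    by (meson of_nat_0_le_iff)
qed

end
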